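(* Let $\{X_E:E\in\mathcal{B}_0\}$ be a free Poisson random measure (with $\alpha=1$) in a $W^*$-probability space $(\mathcal{A},\varphi)$ with $X_E\ge0$ for all $E\in\mathcal{B}_0$, and let $\widetilde{X}_E=X_E-|E|\cdot1$ be the associated centered free Poisson random measure. Let $s=\sum_{i=1}^nc_i\chi_{E_i}$ be a real-valued simple function with $E_1,\dots,E_n\in\mathcal{B}_0$ mutually disjoint, and let $\widetilde{X}(s)=\sum_{i=1}^nc_i\widetilde{X}_{E_i}$. Then $\|\widetilde{X}(s)\|_1\le2\|s\|_1$.
   Context: A $W^*$-probability space $(\mathcal{A},\varphi)$ is a finite von Neumann algebra with a faithful normal tracial state; $\|a\|_1=\varphi(|a|)$ for $a\in\mathcal{A}$, and $\|s\|_1$ is the norm of $L^1(\mathbb{R})$. $\kappa_n(a):=\kappa_n(a,\dots,a)$ denotes the usual $n$-th free cumulant. Free Poisson random measure (with $\alpha=1$): a map $E\mapsto X_E$ from the set $\mathcal{B}_0$ of Borel subsets of $\mathbb{R}$ of finite Lebesgue measure $|E|$ into the self-adjoint elements of $\mathcal{A}$ such that (1) $\kappa_n(X_E)=|E|$ for all $n\ge1$; (2) if $E_1,\dots,E_k$ are mutually disjoint, then $X_{E_1},\dots,X_{E_k}$ are freely independent; (3) if $E_1,\dots,E_k$ are mutually disjoint, then $X_{\cup_{i=1}^kE_i}=\sum_{i=1}^kX_{E_i}$. *)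

theory Defs
  imports "HOL-Analysis.Analysis" "HOL-Library.Disjoint_Sets"
begin

subsection \<open>Operators on a complex Hilbert space\<close>

text \<open>The inner product is conjugate-linear in its first argument.\<close>

class complex_hilbert = banach +
  fixes scaleC :: "complex \<Rightarrow> 'a \<Rightarrow> 'a"  (infixr "*\<^sub>C" 75)
    and cinner :: "'a \<Rightarrow> 'a \<Rightarrow> complex"
  assumes scaleC_add_right: "c *\<^sub>C (x + y) = c *\<^sub>C x + c *\<^sub>C y"
    and scaleC_add_left: "(c + d) *\<^sub>C x = c *\<^sub>C x + d *\<^sub>C x"
    and scaleC_scaleC: "c *\<^sub>C d *\<^sub>C x = (c * d) *\<^sub>C x"
    and scaleC_one: "1 *\<^sub>C x = x"
    and scaleR_scaleC: "r *\<^sub>R x = complex_of_real r *\<^sub>C x"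
    and cinner_commute: "cinner x y = cnj (cinner y x)"
    and cinner_add_right: "cinner x (y + z) = cinner x y + cinner x z"
    and cinner_scaleC_right: "cinner x (c *\<^sub>C y) = c * cinner x y"
    and cinner_self: "cinner x x = complex_of_real ((norm x)\<^sup>2)"

text \<open>The elements of \<open>B(H)\<close> are those \<open>T :: 'h \<Rightarrow>\<^sub>L 'h\<close> (bounded and
  real-linear) that also commute with complex scalars.\<close>

type_synonym 'h operator = "'h \<Rightarrow>\<^sub>L 'h"

definition clinear_op :: "'h::complex_hilbert operator \<Rightarrow> bool" where
  "clinear_op T \<longleftrightarrow> (\<forall>c x. T (c *\<^sub>C x) = c *\<^sub>C T x)"

definition scalar_op :: "complex \<Rightarrow> 'h::complex_hilbert operator" where
  "scalar_op c = Blinfun (\<lambda>x. c *\<^sub>C x)"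

lemma norm_scaleC: "norm (c *\<^sub>C (x::'h::complex_hilbert)) = cmod c * norm x"
proof -
  have "complex_of_real ((norm (c *\<^sub>C x))\<^sup>2) = c * cinner (c *\<^sub>C x) x"
    by (simp only: cinner_self[symmetric] cinner_scaleC_right)
  also have "\<dots> = c * cnj (c * cinner x x)"
    by (subst cinner_commute) (simp only: cinner_scaleC_right)
  also have "\<dots> = (c * cnj c) * complex_of_real ((norm x)\<^sup>2)"
    unfolding cinner_self by simp
  also have "\<dots> = complex_of_real ((cmod c * norm x)\<^sup>2)"
    by (simp add: complex_norm_square[symmetric] power_mult_distrib)
  finally have "(norm (c *\<^sub>C x))\<^sup>2 = (cmod c * norm x)\<^sup>2"
    by (simp only: of_real_eq_iff)
  then show ?thesis
    by (rule power2_eq_imp_eq) simp_all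
qed

lemma scalar_op_apply [simp]: "blinfun_apply (scalar_op c) x = c *\<^sub>C x"
proof -
  have "bounded_linear (\<lambda>y::'a. c *\<^sub>C y)"
  proof (rule bounded_linear_intro[where K = "cmod c"])
    show "c *\<^sub>C (r *\<^sub>R y) = r *\<^sub>R (c *\<^sub>C y)" for r and y :: 'a
      by (simp only: scaleR_scaleC scaleC_scaleC mult.commute[of c])
    show "norm (c *\<^sub>C y) \<le> norm y * cmod c" for y :: 'a
      by (simp only: norm_scaleC mult.commute order.refl)
  qed (rule scaleC_add_right)
  then show ?thesis
    unfolding scalar_op_def by (simp only: bounded_linear_Blinfun_apply)
qed

definition adj_op :: "'h::complex_hilbert operator \<Rightarrow> 'h operator" where
  "adj_op T = (THE S. clinear_op S \<and> (\<forall>x y. cinner (T x) y = cinner x (S y)))"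

definition selfadjoint_op :: "'h::complex_hilbert operator \<Rightarrow> bool" where
  "selfadjoint_op T \<longleftrightarrow> clinear_op T \<and> (\<forall>x y. cinner (T x) y = cinner x (T y))"

definition positive_op :: "'h::complex_hilbert operator \<Rightarrow> bool" where
  "positive_op T \<longleftrightarrow> clinear_op T \<and> (\<forall>x. cinner x (T x) \<in> \<real> \<and> 0 \<le> Re (cinner x (T x)))"

definition op_le :: "'h::complex_hilbert operator \<Rightarrow> 'h operator \<Rightarrow> bool"  (infix "\<sqsubseteq>" 50) where
  "S \<sqsubseteq> T \<longleftrightarrow> positive_op (T - S)"

text \<open>\<open>|T|\<close>, the positive square root of \<open>T\<^sup>*T\<close>.\<close>

definition abs_op :: "'h::complex_hilbert operator \<Rightarrow> 'h operator" where
  "abs_op T = (THE B. positive_op B \<and> B o\<^sub>L B = adj_op T o\<^sub>L T)"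

definition prod_op :: "'h::complex_hilbert operator list \<Rightarrow> 'h operator" where
  "prod_op Ts = foldr (o\<^sub>L) Ts id_blinfun"


subsection \<open>\<open>W\<^sup>*\<close>-probability spaces\<close>

definition commutant :: "'h::complex_hilbert operator set \<Rightarrow> 'h operator set" where
  "commutant A = {T. clinear_op T \<and> (\<forall>a\<in>A. T o\<^sub>L a = a o\<^sub>L T)}"

text \<open>Being a bicommutant, \<open>A\<close> is automatically a unital subalgebra of \<open>B(H)\<close>.\<close>

definition von_neumann_algebra :: "'h::complex_hilbert operator set \<Rightarrow> bool" where
  "von_neumann_algebra A \<longleftrightarrow>
     (\<forall>a\<in>A. clinear_op a \<and> adj_op a \<in> A) \<and> commutant (commutant A) = A"

text \<open>Finiteness: every isometry in \<open>A\<close> is unitary, i.e. the projection \<open>1\<close> is finite.\<close>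

definition finite_von_neumann_algebra :: "'h::complex_hilbert operator set \<Rightarrow> bool" where
  "finite_von_neumann_algebra A \<longleftrightarrow> von_neumann_algebra A \<and>
     (\<forall>v\<in>A. adj_op v o\<^sub>L v = id_blinfun \<longrightarrow> v o\<^sub>L adj_op v = id_blinfun)"

definition is_sup_in :: "'h::complex_hilbert operator set \<Rightarrow> 'h operator set \<Rightarrow> 'h operator \<Rightarrow> bool" where
  "is_sup_in A D s \<longleftrightarrow> s \<in> A \<and> selfadjoint_op s \<and> (\<forall>a\<in>D. a \<sqsubseteq> s) \<and>
     (\<forall>t\<in>A. selfadjoint_op t \<and> (\<forall>a\<in>D. a \<sqsubseteq> t) \<longrightarrow> s \<sqsubseteq> t)"

text \<open>Only the values of \<open>\<phi>\<close> on \<open>A\<close> are relevant.\<close>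

locale wstar_probability_space =
  fixes A :: "'h::complex_hilbert operator set"
    and \<phi> :: "'h operator \<Rightarrow> complex"
  assumes finite_vn: "finite_von_neumann_algebra A"
    and state_add: "\<lbrakk>a \<in> A; b \<in> A\<rbrakk> \<Longrightarrow> \<phi> (a + b) = \<phi> a + \<phi> b"
    and state_scale: "a \<in> A \<Longrightarrow> \<phi> (scalar_op c o\<^sub>L a) = c * \<phi> a"
    and state_positive: "\<lbrakk>a \<in> A; positive_op a\<rbrakk> \<Longrightarrow> \<phi> a \<in> \<real> \<and> 0 \<le> Re (\<phi> a)"
    and state_one: "\<phi> id_blinfun = 1"
    and tracial: "\<lbrakk>a \<in> A; b \<in> A\<rbrakk> \<Longrightarrow> \<phi> (a o\<^sub>L b) = \<phi> (b o\<^sub>L a)"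
    and faithful: "\<lbrakk>a \<in> A; positive_op a; \<phi> a = 0\<rbrakk> \<Longrightarrow> a = 0"
    and normal: "\<lbrakk>D \<subseteq> {a \<in> A. selfadjoint_op a}; D \<noteq> {};
        \<forall>a\<in>D. \<forall>b\<in>D. \<exists>c\<in>D. a \<sqsubseteq> c \<and> b \<sqsubseteq> c; is_sup_in A D s\<rbrakk>
      \<Longrightarrow> Re (\<phi> s) = (SUP a\<in>D. Re (\<phi> a))"

definition trace_norm :: "('h::complex_hilbert operator \<Rightarrow> complex) \<Rightarrow> 'h operator \<Rightarrow> real" where
  "trace_norm \<phi> a = Re (\<phi> (abs_op a))"


subsection \<open>Free independence and free cumulants\<close>

inductive_set unital_alg :: "'h::complex_hilbert operator set \<Rightarrow> 'h operator set"
  for S :: "'h::complex_hilbert operator set" where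
  gen: "a \<in> S \<Longrightarrow> a \<in> unital_alg S"
| one: "id_blinfun \<in> unital_alg S"
| add: "\<lbrakk>a \<in> unital_alg S; b \<in> unital_alg S\<rbrakk> \<Longrightarrow> a + b \<in> unital_alg S"
| scale: "a \<in> unital_alg S \<Longrightarrow> scalar_op c o\<^sub>L a \<in> unital_alg S"
| mult: "\<lbrakk>a \<in> unital_alg S; b \<in> unital_alg S\<rbrakk> \<Longrightarrow> a o\<^sub>L b \<in> unital_alg S"

definition freely_independent ::
    "('h::complex_hilbert operator \<Rightarrow> complex) \<Rightarrow> 'i set \<Rightarrow> ('i \<Rightarrow> 'h operator) \<Rightarrow> bool" where
  "freely_independent \<phi> I X \<longleftrightarrow>
     (\<forall>ks as. as \<noteq> [] \<and> length ks = length as \<and> set ks \<subseteq> I \<and> distinct_adj ks \<and>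
        (\<forall>j<length as. as ! j \<in> unital_alg {X (ks ! j)} \<and> \<phi> (as ! j) = 0)
        \<longrightarrow> \<phi> (prod_op as) = 0)"

definition noncrossing :: "nat set set \<Rightarrow> bool" where
  "noncrossing P \<longleftrightarrow> (\<forall>V\<in>P. \<forall>W\<in>P. \<forall>a b c d.
     a < b \<and> b < c \<and> c < d \<and> a \<in> V \<and> c \<in> V \<and> b \<in> W \<and> d \<in> W \<longrightarrow> V = W)"

definition NC :: "nat \<Rightarrow> nat set set set" where
  "NC n = {P. partition_on {..<n} P \<and> noncrossing P}"

lemma finite_NC: "finite (NC n)"
  by (rule finite_subset[OF _ finitely_many_partition_on[of "{..<n}"]]) (auto simp: NC_def)

lemma length_nths_NC_block:
  assumes "P \<in> NC (length as) - {{{..<length as}}}" "V \<in> P"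
  shows "length (nths as V) < length as"
proof -
  have part: "partition_on {..<length as} P" and ne: "P \<noteq> {{..<length as}}"
    using assms by (auto simp: NC_def)
  have "V \<noteq> {..<length as}"
  proof
    assume V: "V = {..<length as}"
    have "W = V" if W: "W \<in> P" for W
    proof (rule ccontr)
      assume "W \<noteq> V"
      then have "W \<inter> V = {}"
        using partition_onD2[OF part] W assms(2) by (auto simp: disjoint_def)
      moreover have "W \<subseteq> V"
        using partition_onD1[OF part] W V by blast
      moreover have "W \<noteq> {}"
        using partition_onD3[OF part] W by blast
      ultimately show False by blast
    qed
    then have "P = {V}"
      using assms(2) by blast
    then show False using ne V by (simp only: not_True_eq_False)
  qed
  then have "V \<subset> {..<length as}"
    using partition_onD1[OF part] assms(2) by blast
  moreover have "{i. i < length as \<and> i \<in> V} = V"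
    using calculation by blast
  ultimately show ?thesis
    unfolding length_nths using psubset_card_mono[of "{..<length as}" V] by simp
qed

text \<open>The free cumulants \<open>\<kappa>\<^sub>n(a\<^sub>1,\<dots>,a\<^sub>n)\<close>: the moment-cumulant formula
  (see \<open>moment_cumulant\<close> below) solved for the term of the one-block partition.\<close>

function free_cumulant :: "('h::complex_hilbert operator \<Rightarrow> complex) \<Rightarrow> 'h operator list \<Rightarrow> complex" where
  "free_cumulant \<phi> as = \<phi> (prod_op as) -
     (\<Sum>P\<in>NC (length as) - {{{..<length as}}}. \<Prod>V\<in>P. free_cumulant \<phi> (nths as V))"
  by auto
termination
  by (relation "Wellfounded.measure (\<lambda>(\<phi>, as). length as)")
    (simp, simp only: in_measure prod.case length_nths_NC_block)

declare free_cumulant.simps [simp del]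

lemma moment_cumulant:
  assumes "as \<noteq> []"
  shows "\<phi> (prod_op as) = (\<Sum>P\<in>NC (length as). \<Prod>V\<in>P. free_cumulant \<phi> (nths as V))"
proof -
  have "{{..<length as}} \<in> NC (length as)"
    using assms by (auto simp: NC_def noncrossing_def partition_on_def disjoint_def)
  then have "(\<Sum>P\<in>NC (length as). \<Prod>V\<in>P. free_cumulant \<phi> (nths as V)) =
      free_cumulant \<phi> (nths as {..<length as}) +
      (\<Sum>P\<in>NC (length as) - {{{..<length as}}}. \<Prod>V\<in>P. free_cumulant \<phi> (nths as V))"
    by (subst sum.remove[OF finite_NC, of "{{..<length as}}"])
      (simp_all only: prod.insert finite.emptyI empty_iff not_False_eq_True prod.empty mult_1_right)
  moreover have "nths as {..<length as} = as"
    by (rule nths_all) simp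
  ultimately show ?thesis
    by (simp only: free_cumulant.simps[of \<phi> as] diff_add_cancel)
qed


subsection \<open>Free Poisson random measures\<close>

definition finite_borel_sets :: "real set set" where
  "finite_borel_sets = {E \<in> sets borel. emeasure lborel E < \<infinity>}"

definition free_poisson_random_measure ::
    "'h::complex_hilbert operator set \<Rightarrow> ('h operator \<Rightarrow> complex) \<Rightarrow> (real set \<Rightarrow> 'h operator) \<Rightarrow> bool" where
  "free_poisson_random_measure A \<phi> X \<longleftrightarrow>
     (\<forall>E\<in>finite_borel_sets. X E \<in> A \<and> selfadjoint_op (X E)) \<and>
     (\<forall>E\<in>finite_borel_sets. \<forall>n\<ge>1.
        free_cumulant \<phi> (replicate n (X E)) = complex_of_real (measure lborel E)) \<and>
     (\<forall>(k::nat) E. (\<forall>i\<in>{1..k}. E i \<in> finite_borel_sets) \<and> disjoint_family_on E {1..k} \<longrightarrow>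
        freely_independent \<phi> {1..k} (\<lambda>i. X (E i)) \<and>
        X (\<Union>i\<in>{1..k}. E i) = (\<Sum>i=1..k. X (E i)))"

definition centered :: "(real set \<Rightarrow> 'h::complex_hilbert operator) \<Rightarrow> real set \<Rightarrow> 'h operator" where
  "centered X E = X E - measure lborel E *\<^sub>R id_blinfun"

definition L1_norm :: "(real \<Rightarrow> real) \<Rightarrow> real" where
  "L1_norm f = (LINT x|lborel. \<bar>f x\<bar>)"

end

theory Submission
  imports Defs
begin

text \<open>Each centered variable is a difference of the positive elements \<open>X\<^sub>E\<close> and
  \<open>|E| \<cdot> 1\<close>, both of trace \<open>|E|\<close> because the first free cumulant is the mean. So each one has trace
  norm at most \<open>2 |E|\<close>, and the triangle inequality for the trace norm together with the
  disjointness of the sets gives the estimate.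

  All the work lies in the triangle inequality, which is reduced to a duality
  (\<open>trace_norm_le\<close>): for self-adjoint \<open>T\<close> in the algebra, \<open>\<phi> |T|\<close> is bounded by every common
  upper bound of the numbers \<open>Re (\<phi> (u T))\<close>, where \<open>u\<close> runs through the self-adjoint
  contractions of the algebra. Such a functional is linear in \<open>T\<close>, and on a positive element \<open>a\<close> it is
  bounded in modulus by \<open>\<phi> a\<close> (\<open>state_contraction_comp_le\<close>), as traciality makes
  \<open>\<phi> ((1 - u) a)\<close> the value of \<open>\<phi>\<close> at a positive element.

  The optimal \<open>u\<close> would be the sign of \<open>T\<close>, whose construction takes a Borel functional calculus.
  Norm-convergent algebra suffices instead. With \<open>B = |T|\<close>, \<open>r > 0\<close> small and
  \<open>C = 1 - r B\<close>, the sign is replaced by \<open>u = r T (1 + C + \<dots> + C\<^sup>n\<^sup>-\<^sup>1)\<close>, for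
  which \<open>u\<^sup>2 = (1 - C\<^sup>n)\<^sup>2\<close> and \<open>u T = B - C\<^sup>n B\<close>. The defect \<open>\<phi> (C\<^sup>n B)\<close> tends to
  zero, being the general term of a series of nonnegative numbers with partial sums at most
  \<open>1 / r\<close>. The only functional calculus needed is the positive square
  root, obtained from an iteration that converges in norm
  (\<open>positive_contraction_sqrt\<close>).\<close>

section \<open>The inner product\<close>

lemma cinner_add_left: "cinner (x + y) z = cinner x z + cinner (y::'h::complex_hilbert) z"
  by (simp only: cinner_commute[of _ z] cinner_add_right complex_cnj_add)

lemma cinner_scaleC_left: "cinner (c *\<^sub>C x) y = cnj c * cinner (x::'h::complex_hilbert) y"
  by (simp only: cinner_commute[of _ y] cinner_scaleC_right complex_cnj_mult)

lemma norm_add_sq: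
  "(norm (x + y))\<^sup>2 = (norm x)\<^sup>2 + 2 * Re (cinner x y) + (norm (y::'h::complex_hilbert))\<^sup>2"
proof -
  have "Re (cinner (x + y) (x + y)) = Re (cinner x x) + 2 * Re (cinner x y) + Re (cinner y y)"
    by (simp only: cinner_add_left cinner_add_right cinner_commute[of y x])
      (simp add: algebra_simps)
  then show ?thesis
    by (simp add: cinner_self)
qed

lemma Cauchy_Schwarz_cinner: "cmod (cinner x y) \<le> norm x * norm (y::'h::complex_hilbert)"
proof (cases "y = 0")
  case True
  have "cinner x (0::'h) = 0"
    using cinner_add_right[of x "0::'h" 0] by simp
  then show ?thesis using True by simp
next
  case False
  define z where "z = cinner x y"
  \<comment> \<open>the multiple of \<open>y\<close> that makes \<open>x + w *\<^sub>C y\<close> orthogonal to \<open>y\<close>\<close>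
  define w where "w = - cnj z / complex_of_real ((norm y)\<^sup>2)"
  have wz: "w * z = complex_of_real (- (cmod z)\<^sup>2 / (norm y)\<^sup>2)"
    by (simp add: w_def complex_norm_square mult.commute del: of_real_power)
  have w: "cmod w = cmod z / (norm y)\<^sup>2"
    by (simp add: w_def norm_divide norm_power)
  have "0 \<le> (norm (x + w *\<^sub>C y))\<^sup>2"
    by simp
  also have "\<dots> = (norm x)\<^sup>2 + 2 * (- (cmod z)\<^sup>2 / (norm y)\<^sup>2) + (cmod z / (norm y)\<^sup>2 * norm y)\<^sup>2"
    by (simp only: norm_add_sq norm_scaleC cinner_scaleC_right z_def[symmetric] wz w Re_complex_of_real)
  also have "\<dots> = (norm x)\<^sup>2 - (cmod z)\<^sup>2 / (norm y)\<^sup>2"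
    using False by (simp add: field_simps power2_eq_square)
  finally have "(cmod z)\<^sup>2 \<le> (norm x * norm y)\<^sup>2"
    using False by (simp add: field_simps power_mult_distrib)
  then show ?thesis
    unfolding z_def by (rule power2_le_imp_le) simp
qed

lemma bounded_bilinear_cinner:
  "bounded_bilinear (cinner :: 'h::complex_hilbert \<Rightarrow> 'h \<Rightarrow> complex)"
proof
  show "cinner (r *\<^sub>R x) y = r *\<^sub>R cinner x y" for r and x y :: 'h
    by (simp add: scaleR_scaleC cinner_scaleC_left scaleR_conv_of_real)
  show "cinner x (r *\<^sub>R y) = r *\<^sub>R cinner x y" for r and x y :: 'h
    by (simp add: scaleR_scaleC cinner_scaleC_right scaleR_conv_of_real)
  show "\<exists>K. \<forall>x y :: 'h. norm (cinner x y) \<le> norm x * norm y * K"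
    by (intro exI[of _ 1]) (simp add: Cauchy_Schwarz_cinner)
qed (simp_all add: cinner_add_left cinner_add_right)

interpretation cinner: bounded_bilinear "cinner :: 'h::complex_hilbert \<Rightarrow> 'h \<Rightarrow> complex"
  by (rule bounded_bilinear_cinner)

interpretation comp: bounded_bilinear
  "blinfun_compose :: 'h::complex_hilbert operator \<Rightarrow> 'h operator \<Rightarrow> 'h operator"
  by (rule bounded_bilinear_blinfun_compose)

lemma scaleC_bounded_linear_simps:
  fixes x y :: "'h::complex_hilbert"
  shows scaleC_zero: "c *\<^sub>C (0::'h) = 0"
    and scaleC_diff: "c *\<^sub>C (x - y) = c *\<^sub>C x - c *\<^sub>C y"
    and scaleC_scaleR: "c *\<^sub>C (r *\<^sub>R x) = r *\<^sub>R (c *\<^sub>C x)"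
  by (metis scalar_op_apply blinfun.zero_right)
    (metis scalar_op_apply blinfun.diff_right, metis scalar_op_apply blinfun.scaleR_right)

section \<open>Self-adjoint and positive operators\<close>

lemma comp_assoc: "(a o\<^sub>L b) o\<^sub>L c = a o\<^sub>L (b o\<^sub>L (c::'h::complex_hilbert operator))"
  by (rule blinfun_eqI) simp

lemma comp_id [simp]:
  "id_blinfun o\<^sub>L a = a" "a o\<^sub>L id_blinfun = (a::'h::complex_hilbert operator)"
  by (auto intro: blinfun_eqI)

lemma norm_comp_le: "norm (a o\<^sub>L b) \<le> norm a * norm (b::'h::complex_hilbert operator)"
  by (rule norm_blinfun_compose)

lemma adj_op_selfadjoint:
  assumes "selfadjoint_op T" shows "adj_op T = T"
  unfolding adj_op_def
proof (rule the_equality)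
  show "clinear_op T \<and> (\<forall>x y. cinner (T x) y = cinner x (T y))"
    using assms by (simp add: selfadjoint_op_def)
next
  fix S assume S: "clinear_op S \<and> (\<forall>x y. cinner (T x) y = cinner x (S y))"
  show "S = T"
  proof (rule blinfun_eqI)
    fix y
    have "cinner (S y - T y) (S y - T y) = 0"
      using S assms by (simp add: selfadjoint_op_def cinner.diff_right)
    then show "S y = T y"
      by (simp add: cinner_self)
  qed
qed

lemma selfadjoint_add: "selfadjoint_op a \<Longrightarrow> selfadjoint_op b \<Longrightarrow> selfadjoint_op (a + b)"
  and selfadjoint_diff: "selfadjoint_op a \<Longrightarrow> selfadjoint_op b \<Longrightarrow> selfadjoint_op (a - b)"
  and selfadjoint_scaleR: "selfadjoint_op a \<Longrightarrow> selfadjoint_op (r *\<^sub>R a)"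
  and selfadjoint_zero: "selfadjoint_op 0"
  and selfadjoint_id: "selfadjoint_op id_blinfun"
  by (auto simp: selfadjoint_op_def clinear_op_def blinfun.bilinear_simps cinner.add_left
      cinner.add_right cinner.diff_left cinner.diff_right cinner.scaleR_left cinner.scaleR_right
      scaleC_add_right scaleC_diff scaleC_scaleR scaleC_zero cinner.zero_left cinner.zero_right)

lemma selfadjoint_comp:
  "selfadjoint_op a \<Longrightarrow> selfadjoint_op b \<Longrightarrow> a o\<^sub>L b = b o\<^sub>L a \<Longrightarrow> selfadjoint_op (a o\<^sub>L b)"
  by (simp add: selfadjoint_op_def clinear_op_def) (metis blinfun_apply_blinfun_compose)

lemma selfadjoint_sum: "(\<And>i. i \<in> I \<Longrightarrow> selfadjoint_op (f i)) \<Longrightarrow> selfadjoint_op (\<Sum>i\<in>I. f i)"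
  by (induction I rule: infinite_finite_induct) (auto intro: selfadjoint_add selfadjoint_zero)

lemma tendsto_blinfun_apply: "F \<longlonglongrightarrow> T \<Longrightarrow> (\<lambda>n. blinfun_apply (F n) x) \<longlonglongrightarrow> blinfun_apply T x"
  by (rule blinfun.tendsto) auto

lemma selfadjoint_limit:
  assumes "F \<longlonglongrightarrow> T" "\<And>n. selfadjoint_op (F n)"
  shows "selfadjoint_op T"
  unfolding selfadjoint_op_def clinear_op_def
proof (intro conjI allI)
  note lim = tendsto_blinfun_apply[OF assms(1)]
  fix c x
  have "(\<lambda>n. scalar_op c (F n x)) \<longlonglongrightarrow> scalar_op c (T x)"
    by (rule blinfun.tendsto[OF tendsto_const lim])
  moreover have "scalar_op c (F n x) = F n (c *\<^sub>C x)" for n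
    using assms(2)[of n] by (simp add: selfadjoint_op_def clinear_op_def)
  ultimately show "T (c *\<^sub>C x) = c *\<^sub>C T x"
    using LIMSEQ_unique[OF lim[of "c *\<^sub>C x"]] by simp
next
  note lim = tendsto_blinfun_apply[OF assms(1)]
  fix x y
  have "(\<lambda>n. cinner (F n x) y) \<longlonglongrightarrow> cinner (T x) y"
    by (rule cinner.tendsto[OF lim tendsto_const])
  moreover have "(\<lambda>n. cinner (F n x) y) \<longlonglongrightarrow> cinner x (T y)"
    using cinner.tendsto[OF tendsto_const lim] assms(2) by (simp add: selfadjoint_op_def)
  ultimately show "cinner (T x) y = cinner x (T y)"
    by (rule LIMSEQ_unique)
qed

lemma selfadjoint_cinner_Reals: "selfadjoint_op T \<Longrightarrow> cinner x (T x) \<in> \<real>"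
  by (metis selfadjoint_op_def cinner_commute Reals_cnj_iff)

text \<open>On a complex space real-valuedness of \<open>\<langle>x, T x\<rangle>\<close> is enough, by polarization at
  \<open>x + y\<close> and \<open>x + \<i> y\<close>.\<close>

lemma positive_op_selfadjoint:
  assumes "positive_op T" shows "selfadjoint_op T"
  unfolding selfadjoint_op_def
proof (intro conjI allI)
  show T: "clinear_op T" using assms by (simp add: positive_op_def)
  have im: "Im (cinner x (T x)) = 0" for x
    using assms by (auto simp: positive_op_def complex_is_Real_iff)
  fix x y
  have "Im (cinner x (T y)) + Im (cinner y (T x)) = 0"
    using im[of "x + y"] by (simp add: blinfun.add_right cinner.add_left cinner.add_right im)
  moreover have "Re (cinner x (T y)) - Re (cinner y (T x)) = 0"
    using im[of "x + \<i> *\<^sub>C y"] T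
    by (simp add: blinfun.add_right cinner.add_left cinner.add_right im clinear_op_def
        cinner_scaleC_left cinner_scaleC_right)
  ultimately have "cinner x (T y) = cnj (cinner y (T x))"
    by (simp add: complex_eq_iff)
  then show "cinner (T x) y = cinner x (T y)"
    by (metis cinner_commute)
qed

lemma positive_op_iff:
  "positive_op T \<longleftrightarrow> selfadjoint_op T \<and> (\<forall>x. 0 \<le> Re (cinner x (T x)))"
proof
  show "selfadjoint_op T \<and> (\<forall>x. 0 \<le> Re (cinner x (T x)))" if "positive_op T"
    using that by (simp add: positive_op_selfadjoint) (simp add: positive_op_def)
  show "positive_op T" if "selfadjoint_op T \<and> (\<forall>x. 0 \<le> Re (cinner x (T x)))"
    using that by (simp add: positive_op_def selfadjoint_cinner_Reals) (simp add: selfadjoint_op_def)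
qed

lemma positive_op_scaleR: "positive_op a \<Longrightarrow> 0 \<le> r \<Longrightarrow> positive_op (r *\<^sub>R a)"
  by (auto simp: positive_op_iff selfadjoint_scaleR blinfun.scaleR_left cinner.scaleR_right)

lemma positive_op_id: "positive_op id_blinfun"
  by (auto simp: positive_op_iff selfadjoint_id cinner_self)

lemma positive_op_square: "selfadjoint_op a \<Longrightarrow> positive_op (a o\<^sub>L a)"
  unfolding positive_op_iff
  by (auto simp: selfadjoint_comp) (metis selfadjoint_op_def cinner_self Re_complex_of_real zero_le_power2)

lemma positive_op_conjugate:
  assumes "selfadjoint_op s" "positive_op a" shows "positive_op (s o\<^sub>L a o\<^sub>L s)"
proof -
  have "cinner x ((s o\<^sub>L a o\<^sub>L s) y) = cinner (s x) (a (s y))" for x y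
    using assms(1) unfolding selfadjoint_op_def by simp
  moreover have "cinner ((s o\<^sub>L a o\<^sub>L s) x) y = cinner (s x) (a (s y))" for x y
    using assms by (simp add: selfadjoint_op_def positive_op_iff)
  moreover have "clinear_op (s o\<^sub>L a o\<^sub>L s)"
    using assms by (simp add: positive_op_def selfadjoint_op_def clinear_op_def)
  ultimately show ?thesis
    using assms(2) by (simp only: positive_op_iff selfadjoint_op_def) blast
qed

lemma Re_cinner_le:
  fixes a :: "'h::complex_hilbert operator"
  shows "\<bar>Re (cinner x (a x))\<bar> \<le> norm a * (norm x)\<^sup>2"
proof -
  have "\<bar>Re (cinner x (a x))\<bar> \<le> norm x * norm (a x)"
    using abs_Re_le_cmod Cauchy_Schwarz_cinner order_trans by blast
  also have "\<dots> \<le> norm x * (norm a * norm x)"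
    by (intro mult_left_mono norm_blinfun) simp
  finally show ?thesis by (simp add: power2_eq_square mult_ac)
qed

lemma positive_id_diff:
  assumes "selfadjoint_op a" "norm a \<le> 1"
  shows "positive_op (id_blinfun - a)"
proof -
  have "Re (cinner x (a x)) \<le> (norm x)\<^sup>2" for x
    using Re_cinner_le[of x a] mult_right_mono[OF assms(2), of "(norm x)\<^sup>2"] by simp
  then show ?thesis
    using assms by (auto simp: positive_op_iff selfadjoint_diff selfadjoint_id blinfun.diff_left
        cinner.diff_right cinner_self)
qed

text \<open>This is \<open>a\<^sup>2 \<le> a\<close> for a positive contraction. It follows by expanding
  \<open>0 \<le> \<langle>x - a x, a (x - a x)\<rangle>\<close>, with no spectral theory. Both the contractivity of \<open>1 - a\<close>
  and the fact that \<open>\<langle>x, a x\<rangle> = 0\<close> forces \<open>a x = 0\<close> are consequences.\<close>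

lemma positive_contraction_norm_sq_le:
  assumes "positive_op a" "norm a \<le> 1"
  shows "(norm (a x))\<^sup>2 \<le> Re (cinner x (a x))"
proof -
  have sa: "cinner (a u) v = cinner u (a v)" for u v
    using assms(1) by (simp add: positive_op_iff selfadjoint_op_def)
  have "0 \<le> Re (cinner (x - a x) (a (x - a x)))"
    using assms(1) by (simp only: positive_op_iff)
  also have "\<dots> = Re (cinner x (a x)) - 2 * (norm (a x))\<^sup>2 + Re (cinner (a x) (a (a x)))"
    by (simp add: blinfun.diff_right cinner.diff_left cinner.diff_right cinner_self flip: sa)
      (simp add: sa cinner_self flip: sa[of _ "a x"])
  also have "Re (cinner (a x) (a (a x))) \<le> (norm (a x))\<^sup>2"
    using Re_cinner_le[of "a x" a] mult_right_mono[OF assms(2), of "(norm (a x))\<^sup>2"] by simp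
  finally show ?thesis by simp
qed

lemma positive_contraction_complement:
  assumes "positive_op a" "norm a \<le> 1"
  shows "norm (id_blinfun - a) \<le> 1"
proof (rule norm_blinfun_bound)
  fix x
  have "(norm (x - a x))\<^sup>2 = (norm x)\<^sup>2 - 2 * Re (cinner x (a x)) + (norm (a x))\<^sup>2"
    using norm_add_sq[of x "- a x"] by (simp add: cinner.minus_right)
  also have "\<dots> \<le> (norm x)\<^sup>2"
    using positive_contraction_norm_sq_le[OF assms, of x] assms(1)
    by (simp add: positive_op_iff) (smt (verit))
  finally show "norm ((id_blinfun - a) x) \<le> 1 * norm x"
    using power2_le_imp_le[OF _ norm_ge_zero] by (simp add: blinfun.diff_left)
qed simp

lemma normalizing_factor:
  fixes a :: "'a::real_normed_vector"
  obtains r :: real where "0 < r" "norm (r *\<^sub>R a) \<le> 1"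
  by (rule that[of "1 / (1 + norm a)"]) (auto simp: field_simps add_pos_nonneg)

lemma positive_op_kernel:
  assumes "positive_op a" "Re (cinner x (a x)) = 0"
  shows "a x = 0"
proof -
  obtain r where r: "0 < r" "norm (r *\<^sub>R a) \<le> 1"
    by (rule normalizing_factor)
  have "(norm ((r *\<^sub>R a) x))\<^sup>2 \<le> Re (cinner x ((r *\<^sub>R a) x))"
    by (rule positive_contraction_norm_sq_le) (use assms r in \<open>auto intro: positive_op_scaleR\<close>)
  also have "\<dots> = 0"
    using assms(2) by (simp add: blinfun.scaleR_left cinner.scaleR_right)
  finally show ?thesis
    using r(1) by (simp add: blinfun.scaleR_left)
qed

section \<open>Square roots and the absolute value\<close>

text \<open>Since \<open>(1 - Y)\<^sup>2 = 1 - S\<close> exactly when \<open>2 Y = S + Y\<^sup>2\<close>, the square root of \<open>1 - S\<close> is sought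
  as \<open>1 - Y\<close> for a fixed point \<open>Y\<close> of \<open>Y \<mapsto> (S + Y\<^sup>2) / 2\<close>, approached by iteration from \<open>0\<close>.\<close>

primrec sqrt_iter :: "'h::complex_hilbert operator \<Rightarrow> nat \<Rightarrow> 'h operator" where
  "sqrt_iter S 0 = 0"
| "sqrt_iter S (Suc n) = (1/2) *\<^sub>R (S + (sqrt_iter S n o\<^sub>L sqrt_iter S n))"

text \<open>The iteration for the scalar \<open>S = 1\<close>. It increases and is bounded by \<open>1\<close>, and it dominates the
  operator iteration for every contraction \<open>S\<close>, increment by increment. This gives norm convergence
  even when \<open>S\<close> has norm \<open>1\<close>, where the iterated map is not a strict contraction.\<close>

primrec sqrt_majorant :: "nat \<Rightarrow> real" where
  "sqrt_majorant 0 = 0"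
| "sqrt_majorant (Suc n) = (1 + (sqrt_majorant n)\<^sup>2) / 2"

lemma sqrt_majorant_bounds: "0 \<le> sqrt_majorant n \<and> sqrt_majorant n \<le> 1"
proof (induction n)
  case (Suc n)
  then have "(sqrt_majorant n)\<^sup>2 \<le> 1"
    by (simp add: power_le_one)
  then show ?case by simp
qed simp

lemma sqrt_majorant_incseq: "incseq sqrt_majorant"
proof (rule incseq_SucI)
  fix n
  have "0 \<le> (1 - sqrt_majorant n)\<^sup>2"
    by simp
  then show "sqrt_majorant n \<le> sqrt_majorant (Suc n)"
    by (simp add: power2_eq_square algebra_simps)
qed

lemma norm_sqrt_iter_le:
  assumes "norm S \<le> 1" shows "norm (sqrt_iter S n) \<le> sqrt_majorant n"
proof (induction n)
  case (Suc n)
  have "norm (sqrt_iter S n o\<^sub>L sqrt_iter S n) \<le> sqrt_majorant n * sqrt_majorant n"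
    by (rule order_trans[OF norm_comp_le]) (intro mult_mono Suc norm_ge_zero, use sqrt_majorant_bounds in simp)
  then have "norm (S + (sqrt_iter S n o\<^sub>L sqrt_iter S n)) \<le> 1 + sqrt_majorant n * sqrt_majorant n"
    using norm_triangle_ineq[of S "sqrt_iter S n o\<^sub>L sqrt_iter S n"] assms by linarith
  then show ?case by (simp add: power2_eq_square)
qed simp

lemma norm_sqrt_iter_diff_le:
  assumes "norm S \<le> 1"
  shows "norm (sqrt_iter S (Suc n) - sqrt_iter S n) \<le> sqrt_majorant (Suc n) - sqrt_majorant n"
proof (induction n)
  case 0
  then show ?case using assms by simp
next
  case (Suc n)
  define Y where "Y = sqrt_iter S"
  define y where "y = sqrt_majorant"
  have Y: "norm (Y k) \<le> y k" for k
    using norm_sqrt_iter_le[OF assms] by (simp add: Y_def y_def)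
  have IH: "norm (Y (Suc n) - Y n) \<le> y (Suc n) - y n"
    using Suc by (simp add: Y_def y_def)
  have "Y (Suc (Suc n)) - Y (Suc n) =
      (1/2) *\<^sub>R ((Y (Suc n) o\<^sub>L Y (Suc n)) - (Y n o\<^sub>L Y n))"
    by (simp add: Y_def algebra_simps)
  \<comment> \<open>the factorization \<open>Y\<^sup>2 - Z\<^sup>2 = Y (Y - Z) + (Y - Z) Z\<close>, valid without commutativity\<close>
  also have "\<dots> = (1/2) *\<^sub>R ((Y (Suc n) o\<^sub>L (Y (Suc n) - Y n)) + ((Y (Suc n) - Y n) o\<^sub>L Y n))"
    by (simp add: comp.diff_left comp.diff_right)
  finally have "norm (Y (Suc (Suc n)) - Y (Suc n)) =
      norm ((Y (Suc n) o\<^sub>L (Y (Suc n) - Y n)) + ((Y (Suc n) - Y n) o\<^sub>L Y n)) / 2"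
    by simp
  also have "norm ((Y (Suc n) o\<^sub>L (Y (Suc n) - Y n)) + ((Y (Suc n) - Y n) o\<^sub>L Y n))
      \<le> y (Suc n) * (y (Suc n) - y n) + (y (Suc n) - y n) * y n"
    by (intro norm_triangle_le add_mono order_trans[OF norm_comp_le] mult_mono Y IH)
      (use sqrt_majorant_bounds order_trans[OF norm_ge_zero IH] in \<open>auto simp: y_def\<close>)
  also have "\<dots> / 2 = y (Suc (Suc n)) - y (Suc n)"
    by (simp add: y_def power2_eq_square algebra_simps add_divide_distrib diff_divide_distrib)
  finally show ?case by (simp add: Y_def y_def divide_right_mono)
qed

lemma convergent_sqrt_iter:
  assumes "norm S \<le> 1" shows "convergent (sqrt_iter S)"
proof -
  obtain l where "sqrt_majorant \<longlonglongrightarrow> l"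
    using incseq_convergent[OF sqrt_majorant_incseq, of 1] sqrt_majorant_bounds by blast
  then have "summable (\<lambda>n. sqrt_majorant (Suc n) - sqrt_majorant n)"
    by (rule telescope_summable)
  then have "summable (\<lambda>n. sqrt_iter S (Suc n) - sqrt_iter S n)"
    by (rule summable_comparison_test') (rule norm_sqrt_iter_diff_le[OF assms])
  then have "convergent (\<lambda>n. \<Sum>k<n. sqrt_iter S (Suc k) - sqrt_iter S k)"
    by (simp add: summable_iff_convergent)
  then show ?thesis
    by (simp only: sum_lessThan_telescope sqrt_iter.simps(1) diff_zero)
qed

lemma sqrt_iter_commute:
  assumes "R o\<^sub>L S = S o\<^sub>L R" shows "R o\<^sub>L sqrt_iter S n = sqrt_iter S n o\<^sub>L R"
proof (induction n)
  case (Suc n)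
  then have "R o\<^sub>L (sqrt_iter S n o\<^sub>L sqrt_iter S n) = (sqrt_iter S n o\<^sub>L sqrt_iter S n) o\<^sub>L R"
    by (metis comp_assoc)
  then show ?case
    using assms by (simp add: comp.add_left comp.add_right comp.scaleR_left comp.scaleR_right)
qed (simp add: comp.zero_left comp.zero_right)

lemma selfadjoint_sqrt_iter: "selfadjoint_op S \<Longrightarrow> selfadjoint_op (sqrt_iter S n)"
  by (induction n) (auto intro: selfadjoint_zero selfadjoint_scaleR selfadjoint_add selfadjoint_comp)

text \<open>The root commutes with everything that commutes with \<open>P\<close>, because all the iterates do. This
  clause is what makes square roots unique and places them in the von Neumann algebra.\<close>

lemma positive_contraction_sqrt:
  fixes P :: "'h::complex_hilbert operator"
  assumes P: "positive_op P" "norm P \<le> 1"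
  obtains B where "positive_op B" "B o\<^sub>L B = P"
    "\<And>R. R o\<^sub>L P = P o\<^sub>L R \<Longrightarrow> R o\<^sub>L B = B o\<^sub>L R"
proof -
  define S where "S = id_blinfun - P"
  have S: "norm S \<le> 1" "selfadjoint_op S"
    using positive_contraction_complement[OF P] P
    by (auto simp: S_def positive_op_iff selfadjoint_diff selfadjoint_id)
  obtain Y where lim: "sqrt_iter S \<longlonglongrightarrow> Y"
    using convergent_sqrt_iter[OF S(1)] by (auto simp: convergent_def)
  have "(\<lambda>n. sqrt_iter S (Suc n)) \<longlonglongrightarrow> (1/2) *\<^sub>R (S + (Y o\<^sub>L Y))"
    unfolding sqrt_iter.simps by (intro tendsto_intros comp.tendsto lim)
  then have "Y = (1/2) *\<^sub>R (S + (Y o\<^sub>L Y))"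
    using LIMSEQ_Suc[OF lim] LIMSEQ_unique by blast
  then have "2 *\<^sub>R Y = 2 *\<^sub>R ((1/2) *\<^sub>R (S + (Y o\<^sub>L Y)))"
    by (rule arg_cong)
  then have fixpoint: "2 *\<^sub>R Y = S + (Y o\<^sub>L Y)"
    by simp
  have "norm (sqrt_iter S n) \<le> 1" for n
    using norm_sqrt_iter_le[OF S(1)] sqrt_majorant_bounds order_trans by blast
  then have "norm Y \<le> 1"
    using LIMSEQ_le_const2[OF tendsto_norm[OF lim]] by blast
  moreover have "selfadjoint_op Y"
    using selfadjoint_limit[OF lim] selfadjoint_sqrt_iter[OF S(2)] by blast
  ultimately have "positive_op (id_blinfun - Y)"
    using positive_id_diff by blast
  moreover have "(id_blinfun - Y) o\<^sub>L (id_blinfun - Y) = P"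
  proof -
    have "(id_blinfun - Y) o\<^sub>L (id_blinfun - Y) = id_blinfun - 2 *\<^sub>R Y + (Y o\<^sub>L Y)"
      by (simp add: comp.diff_left comp.diff_right scaleR_2)
    then show ?thesis
      by (simp add: fixpoint S_def)
  qed
  moreover have "R o\<^sub>L (id_blinfun - Y) = (id_blinfun - Y) o\<^sub>L R" if "R o\<^sub>L P = P o\<^sub>L R" for R
  proof -
    have "R o\<^sub>L S = S o\<^sub>L R"
      using that by (simp add: S_def comp.diff_left comp.diff_right)
    then have "(\<lambda>n. R o\<^sub>L sqrt_iter S n) = (\<lambda>n. sqrt_iter S n o\<^sub>L R)"
      using sqrt_iter_commute by blast
    then have "R o\<^sub>L Y = Y o\<^sub>L R"
      using comp.tendsto[OF tendsto_const lim, of R] comp.tendsto[OF lim tendsto_const, of R]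
      by (metis LIMSEQ_unique)
    then show ?thesis
      by (simp add: comp.diff_left comp.diff_right)
  qed
  ultimately show ?thesis
    using that by blast
qed

lemma positive_sqrt:
  fixes P :: "'h::complex_hilbert operator"
  assumes "positive_op P"
  obtains B where "positive_op B" "B o\<^sub>L B = P"
    "\<And>R. R o\<^sub>L P = P o\<^sub>L R \<Longrightarrow> R o\<^sub>L B = B o\<^sub>L R"
proof -
  obtain r where r: "0 < r" "norm (r *\<^sub>R P) \<le> 1"
    by (rule normalizing_factor)
  obtain B where B: "positive_op B" "B o\<^sub>L B = r *\<^sub>R P"
    "\<And>R. R o\<^sub>L (r *\<^sub>R P) = (r *\<^sub>R P) o\<^sub>L R \<Longrightarrow> R o\<^sub>L B = B o\<^sub>L R"
    using positive_contraction_sqrt[of "r *\<^sub>R P"] r assms positive_op_scaleR by (metis less_imp_le)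
  define q where "q = 1 / sqrt r"
  have "q * q * r = 1"
    using r by (simp add: q_def field_simps)
  then have "(q *\<^sub>R B) o\<^sub>L (q *\<^sub>R B) = P"
    by (simp add: comp.scaleR_left comp.scaleR_right B(2) mult.assoc)
  moreover have "positive_op (q *\<^sub>R B)"
    using B(1) r by (intro positive_op_scaleR) (auto simp: q_def)
  moreover have "R o\<^sub>L (q *\<^sub>R B) = (q *\<^sub>R B) o\<^sub>L R" if "R o\<^sub>L P = P o\<^sub>L R" for R
    using B(3)[of R] that by (simp add: comp.scaleR_left comp.scaleR_right)
  ultimately show ?thesis
    using that by blast
qed

text \<open>For \<open>y = (B - C) x\<close> the identity \<open>(B + C) (B - C) = 0\<close> makes
  \<open>\<langle>y, B y\<rangle> + \<langle>y, C y\<rangle>\<close> vanish. Positivity then gives \<open>B y = C y = 0\<close>, so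
  \<open>(B - C)\<^sup>2 x = 0\<close> and hence \<open>(B - C) x = 0\<close>.\<close>

lemma commuting_positive_eqI:
  fixes B C :: "'h::complex_hilbert operator"
  assumes B: "positive_op B" and C: "positive_op C"
    and sq: "B o\<^sub>L B = C o\<^sub>L C" and comm: "B o\<^sub>L C = C o\<^sub>L B"
  shows "B = C"
proof (rule blinfun_eqI)
  fix x
  define y where "y = (B - C) x"
  have "(B + C) o\<^sub>L (B - C) = 0"
    using sq comm by (simp add: comp.add_left comp.diff_right)
  then have "(B + C) y = 0"
    unfolding y_def by (metis blinfun_apply_blinfun_compose zero_blinfun.rep_eq)
  then have "Re (cinner y (B y)) + Re (cinner y (C y)) = 0"
    by (simp add: blinfun.add_left cinner.zero_right flip: plus_complex.sel cinner.add_right)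
  moreover have "0 \<le> Re (cinner y (B y))" "0 \<le> Re (cinner y (C y))"
    using B C by (auto simp: positive_op_iff)
  ultimately have "B y = 0" "C y = 0"
    using positive_op_kernel[OF B] positive_op_kernel[OF C] by (smt (verit))+
  then have "(B - C) y = 0"
    by (simp add: blinfun.diff_left)
  moreover have "selfadjoint_op (B - C)"
    using B C by (simp add: positive_op_iff selfadjoint_diff)
  ultimately have "cinner y y = 0"
    unfolding y_def selfadjoint_op_def by (metis cinner.zero_right)
  then show "B x = C x"
    by (simp add: cinner_self y_def blinfun.diff_left)
qed

text \<open>The definite description is resolved by uniqueness: any positive \<open>C\<close> with \<open>C\<^sup>2 = T\<^sup>2\<close> commutes
  with \<open>T\<^sup>2\<close>, hence with the constructed root.\<close>

lemma abs_op_selfadjoint: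
  fixes T :: "'h::complex_hilbert operator"
  assumes T: "selfadjoint_op T"
  shows "positive_op (abs_op T)" and "abs_op T o\<^sub>L abs_op T = T o\<^sub>L T"
    and "\<And>R. R o\<^sub>L T = T o\<^sub>L R \<Longrightarrow> R o\<^sub>L abs_op T = abs_op T o\<^sub>L R"
proof -
  obtain B where B: "positive_op B" "B o\<^sub>L B = T o\<^sub>L T"
    "\<And>R. R o\<^sub>L (T o\<^sub>L T) = (T o\<^sub>L T) o\<^sub>L R \<Longrightarrow> R o\<^sub>L B = B o\<^sub>L R"
    using positive_sqrt[OF positive_op_square[OF T]] by blast
  have "abs_op T = B"
    unfolding abs_op_def adj_op_selfadjoint[OF T]
  proof (rule the_equality)
    fix C assume C: "positive_op C \<and> C o\<^sub>L C = T o\<^sub>L T"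
    then have "C o\<^sub>L (T o\<^sub>L T) = (T o\<^sub>L T) o\<^sub>L C"
      by (metis comp_assoc)
    then have "C o\<^sub>L B = B o\<^sub>L C"
      by (rule B(3))
    then show "C = B"
      using commuting_positive_eqI[of C B] B(1,2) C by simp
  qed (use B(1,2) in simp)
  moreover have "R o\<^sub>L (T o\<^sub>L T) = (T o\<^sub>L T) o\<^sub>L R" if "R o\<^sub>L T = T o\<^sub>L R" for R
    using that by (metis comp_assoc)
  ultimately show "positive_op (abs_op T)" "abs_op T o\<^sub>L abs_op T = T o\<^sub>L T"
    "\<And>R. R o\<^sub>L T = T o\<^sub>L R \<Longrightarrow> R o\<^sub>L abs_op T = abs_op T o\<^sub>L R"
    using B by blast+
qed

text \<open>If \<open>s\<^sup>2 = P\<close> and \<open>s\<close> commutes with \<open>Q\<close>, then \<open>P Q = s Q s\<close>.\<close>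

lemma positive_comp_commuting:
  assumes "positive_op P" "positive_op Q" "P o\<^sub>L Q = Q o\<^sub>L P"
  shows "positive_op (P o\<^sub>L Q)"
proof -
  obtain s where s: "positive_op s" "s o\<^sub>L s = P"
    "\<And>R. R o\<^sub>L P = P o\<^sub>L R \<Longrightarrow> R o\<^sub>L s = s o\<^sub>L R"
    using positive_sqrt[OF assms(1)] by blast
  have "P o\<^sub>L Q = s o\<^sub>L Q o\<^sub>L s"
    using s(2) s(3)[of Q] assms(3) by (metis comp_assoc)
  then show ?thesis
    using positive_op_conjugate[OF positive_op_selfadjoint[OF s(1)] assms(2)] by simp
qed

primrec op_power :: "'h::complex_hilbert operator \<Rightarrow> nat \<Rightarrow> 'h operator" where
  "op_power C 0 = id_blinfun"
| "op_power C (Suc n) = C o\<^sub>L op_power C n"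

lemma op_power_commute:
  "R o\<^sub>L C = C o\<^sub>L R \<Longrightarrow> R o\<^sub>L op_power C n = op_power C n o\<^sub>L R"
  by (induction n) (simp, metis comp_assoc op_power.simps(2))

lemma positive_op_power: "positive_op C \<Longrightarrow> positive_op (op_power C n)"
  by (induction n) (auto intro: positive_op_id positive_comp_commuting op_power_commute)

lemma norm_op_power_le:
  assumes "norm C \<le> 1" shows "norm (op_power C n) \<le> 1"
proof (induction n)
  case 0
  show ?case by (simp add: norm_blinfun_id_le)
next
  case (Suc n)
  have "norm (C o\<^sub>L op_power C n) \<le> 1 * 1"
    by (rule order_trans[OF norm_comp_le]) (intro mult_mono assms Suc, simp_all)
  then show ?case by simp
qed

section \<open>The trace\<close>

lemma commutant_closed:
  shows commutant_id: "id_blinfun \<in> commutant M"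
    and commutant_add: "a \<in> commutant M \<Longrightarrow> b \<in> commutant M \<Longrightarrow> a + b \<in> commutant M"
    and commutant_comp: "a \<in> commutant M \<Longrightarrow> b \<in> commutant M \<Longrightarrow> a o\<^sub>L b \<in> commutant M"
    and commutant_scaleR: "a \<in> commutant M \<Longrightarrow> r *\<^sub>R a \<in> commutant M"
  unfolding commutant_def
  by (auto simp: clinear_op_def blinfun.bilinear_simps comp.add_left comp.add_right
      comp.scaleR_left comp.scaleR_right scaleC_add_right scaleC_scaleR)
    (metis comp_assoc)

lemma bicommutant_memI:
  assumes "commutant (commutant A) = A" "a \<in> A" "clinear_op b"
    and "\<And>R. R o\<^sub>L a = a o\<^sub>L R \<Longrightarrow> R o\<^sub>L b = b o\<^sub>L R"
  shows "b \<in> A"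
proof -
  have "b \<in> commutant (commutant A)"
    using assms(2-4) unfolding commutant_def by fastforce
  then show ?thesis using assms(1) by simp
qed

context wstar_probability_space
begin

lemma bicommutant: "commutant (commutant A) = A"
  using finite_vn by (simp add: finite_von_neumann_algebra_def von_neumann_algebra_def)

lemma A_closed:
  shows A_id: "id_blinfun \<in> A"
    and A_add: "a \<in> A \<Longrightarrow> b \<in> A \<Longrightarrow> a + b \<in> A"
    and A_comp: "a \<in> A \<Longrightarrow> b \<in> A \<Longrightarrow> a o\<^sub>L b \<in> A"
    and A_scaleR: "a \<in> A \<Longrightarrow> r *\<^sub>R a \<in> A"
  using commutant_id commutant_add commutant_comp commutant_scaleR bicommutant by metis+

lemma A_diff: "a \<in> A \<Longrightarrow> b \<in> A \<Longrightarrow> a - b \<in> A"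
  using A_add[of a "(-1) *\<^sub>R b"] A_scaleR[of b "-1"] by simp

lemma A_sum: "(\<And>i. i \<in> I \<Longrightarrow> f i \<in> A) \<Longrightarrow> (\<Sum>i\<in>I. f i) \<in> A"
  using A_scaleR[OF A_id, of 0]
  by (induction I rule: infinite_finite_induct) (auto intro: A_add)

lemma A_op_power: "a \<in> A \<Longrightarrow> op_power a n \<in> A"
  by (induction n) (auto intro: A_id A_comp)

lemma state_scaleR: "a \<in> A \<Longrightarrow> \<phi> (r *\<^sub>R a) = complex_of_real r * \<phi> a"
proof -
  have "r *\<^sub>R a = scalar_op (complex_of_real r) o\<^sub>L a"
    by (rule blinfun_eqI) (simp add: scaleR_scaleC blinfun.scaleR_left)
  then show "a \<in> A \<Longrightarrow> ?thesis"
    by (simp add: state_scale)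
qed

lemma state_diff: "a \<in> A \<Longrightarrow> b \<in> A \<Longrightarrow> \<phi> (a - b) = \<phi> a - \<phi> b"
  using state_add[of a "(-1) *\<^sub>R b"] A_scaleR[of b "-1"] state_scaleR[of b "-1"] by simp

lemma state_sum: "(\<And>i. i \<in> I \<Longrightarrow> f i \<in> A) \<Longrightarrow> \<phi> (\<Sum>i\<in>I. f i) = (\<Sum>i\<in>I. \<phi> (f i))"
proof (induction I rule: infinite_finite_induct)
  case (insert i I)
  then show ?case by (simp add: state_add A_sum)
qed (use state_scaleR[OF A_id, of 0] in simp_all)

lemma state_nonneg: "a \<in> A \<Longrightarrow> positive_op a \<Longrightarrow> 0 \<le> Re (\<phi> a)"
  using state_positive by blast

text \<open>The product need not be positive, but with \<open>s\<^sup>2 = a\<close> the trace property turns \<open>\<phi> (s s b)\<close>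
  into \<open>\<phi> (s b s)\<close>.\<close>

lemma state_positive_comp:
  assumes "a \<in> A" "b \<in> A" "positive_op a" "positive_op b"
  shows "0 \<le> Re (\<phi> (a o\<^sub>L b))"
proof -
  obtain s where s: "positive_op s" "s o\<^sub>L s = a"
    "\<And>R. R o\<^sub>L a = a o\<^sub>L R \<Longrightarrow> R o\<^sub>L s = s o\<^sub>L R"
    using positive_sqrt[OF assms(3)] by blast
  have sA: "s \<in> A"
    using s(1) by (intro bicommutant_memI[OF bicommutant assms(1) _ s(3)]) (simp_all add: positive_op_def)
  have "\<phi> (a o\<^sub>L b) = \<phi> (s o\<^sub>L (s o\<^sub>L b))"
    by (simp add: comp_assoc flip: s(2))
  also have "\<dots> = \<phi> (s o\<^sub>L b o\<^sub>L s)"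
    by (intro tracial A_comp sA assms)
  finally show ?thesis
    using positive_op_conjugate[OF positive_op_selfadjoint[OF s(1)] assms(4)]
    by (simp add: state_nonneg A_comp sA assms)
qed

text \<open>Both \<open>1 - u\<close> and \<open>1 + u\<close> are positive, so both have nonnegative pairing with \<open>a\<close>.\<close>

lemma state_contraction_comp_le:
  assumes "u \<in> A" "selfadjoint_op u" "norm u \<le> 1" "a \<in> A" "positive_op a"
  shows "\<bar>Re (\<phi> (u o\<^sub>L a))\<bar> \<le> Re (\<phi> a)"
proof -
  have "Re (\<phi> (v o\<^sub>L a)) \<le> Re (\<phi> a)" if "v \<in> A" "selfadjoint_op v" "norm v \<le> 1" for v
  proof -
    have "0 \<le> Re (\<phi> ((id_blinfun - v) o\<^sub>L a))"
      by (intro state_positive_comp A_diff A_id positive_id_diff that assms)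
    then show ?thesis
      using that assms by (simp add: comp.diff_left state_diff A_comp)
  qed
  from this[of u] this[of "(-1) *\<^sub>R u"] show ?thesis
    using assms state_scaleR[OF A_comp[of u a], of "-1"] A_scaleR[of u "-1"]
      selfadjoint_scaleR[of u "-1"]
    by (simp add: comp.minus_left)
qed

text \<open>One half of the duality between the trace norm and the operator norm. The bound is tested on
  contractions \<open>u = T W\<^sub>n\<close>, where \<open>W\<^sub>n = r (1 + C + \<dots> + C\<^sup>n\<^sup>-\<^sup>1)\<close> is a partial Neumann series
  for the formal inverse of \<open>B = |T|\<close>, so that \<open>u\<close> approximates the sign of \<open>T\<close>.\<close>

lemma trace_norm_le:
  assumes T: "T \<in> A" "selfadjoint_op T"
    and K: "\<And>u. u \<in> A \<Longrightarrow> selfadjoint_op u \<Longrightarrow> norm u \<le> 1 \<Longrightarrow> Re (\<phi> (u o\<^sub>L T)) \<le> K"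
  shows "trace_norm \<phi> T \<le> K"
proof -
  define B where "B = abs_op T"
  have B: "positive_op B" "B o\<^sub>L B = T o\<^sub>L T" "T o\<^sub>L B = B o\<^sub>L T"
    using abs_op_selfadjoint(1,2)[OF T(2)] abs_op_selfadjoint(3)[OF T(2) refl] by (simp_all add: B_def)
  have BA: "B \<in> A"
    using B(1) unfolding B_def
    by (intro bicommutant_memI[OF bicommutant T(1) _ abs_op_selfadjoint(3)[OF T(2)]])
      (simp_all add: positive_op_def)
  obtain r where r: "0 < r" "norm (r *\<^sub>R B) \<le> 1"
    by (rule normalizing_factor)
  define C where "C = id_blinfun - r *\<^sub>R B"
  have rB: "positive_op (r *\<^sub>R B)"
    using B(1) r(1) by (simp add: positive_op_scaleR)
  have C: "positive_op C" "norm C \<le> 1" "C \<in> A"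
    using positive_id_diff[OF positive_op_selfadjoint[OF rB] r(2)]
      positive_contraction_complement[OF rB r(2)]
    by (auto simp: C_def intro: A_diff A_id A_scaleR BA)
  define D where "D = op_power C"
  have D: "positive_op (D n)" "norm (D n) \<le> 1" "D n \<in> A" for n
    using C by (auto simp: D_def positive_op_power norm_op_power_le A_op_power)
  define W where "W n = r *\<^sub>R (\<Sum>k<n. D k)" for n
  have WA: "W n \<in> A" and Wsa: "selfadjoint_op (W n)" for n
    unfolding W_def by (intro A_scaleR A_sum D)
      (intro selfadjoint_scaleR selfadjoint_sum positive_op_selfadjoint D)
  have DT: "T o\<^sub>L D k = D k o\<^sub>L T" and DB: "B o\<^sub>L D k = D k o\<^sub>L B" for k
    unfolding D_def C_def
    by (rule op_power_commute; simp add: comp.diff_left comp.diff_right comp.scaleR_left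
        comp.scaleR_right B(3))+
  have WT: "T o\<^sub>L W n = W n o\<^sub>L T" and WB: "B o\<^sub>L W n = W n o\<^sub>L B" for n
    by (simp_all add: W_def comp.scaleR_left comp.scaleR_right comp.sum_left comp.sum_right DT DB)
  have BW: "B o\<^sub>L W n = id_blinfun - D n" for n
  proof -
    have "(r *\<^sub>R B) o\<^sub>L D k = D k - D (Suc k)" for k
      by (simp add: D_def C_def comp.diff_left)
    then have "(\<Sum>k<n. (r *\<^sub>R B) o\<^sub>L D k) = D 0 - D n"
      by (simp add: sum_lessThan_telescope')
    then show ?thesis
      by (simp add: W_def D_def comp.scaleR_left comp.scaleR_right comp.sum_right scaleR_sum_right)
  qed
  have defect: "Re (\<phi> B) - K \<le> Re (\<phi> (D n o\<^sub>L B))" for n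
  proof -
    define u where "u = T o\<^sub>L W n"
    have usa: "selfadjoint_op u"
      unfolding u_def by (intro selfadjoint_comp T Wsa WT)
    have uA: "u \<in> A"
      unfolding u_def by (intro A_comp T WA)
    have DnD: "norm (id_blinfun - D n) \<le> 1" "selfadjoint_op (id_blinfun - D n)"
      using positive_contraction_complement[OF D(1,2)] D(1)
      by (auto simp: selfadjoint_diff selfadjoint_id positive_op_selfadjoint)
    \<comment> \<open>\<open>T\<^sup>2 = B\<^sup>2\<close> and everything commutes, so \<open>u\<^sup>2 = (B W\<^sub>n)\<^sup>2\<close>; hence \<open>u\<close> and \<open>1 - D\<^sub>n\<close> have the
      same norm at every vector\<close>
    have uu: "u o\<^sub>L u = (id_blinfun - D n) o\<^sub>L (id_blinfun - D n)"
      unfolding u_def BW[symmetric] using WT[of n] WB[of n] B(2) by (metis comp_assoc)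
    have "norm u \<le> 1"
    proof (rule norm_blinfun_bound)
      fix x :: 'h
      have sq: "Re (cinner x ((a o\<^sub>L a) x)) = (norm (a x))\<^sup>2" if "selfadjoint_op a" for a
        using that cinner_self[of "a x"] by (simp add: selfadjoint_op_def)
      have "norm (u x) = norm ((id_blinfun - D n) x)"
        using sq[OF usa] sq[OF DnD(2)] uu by simp
      also have "\<dots> \<le> norm (id_blinfun - D n) * norm x"
        by (rule norm_blinfun)
      also have "\<dots> \<le> 1 * norm x"
        by (intro mult_right_mono DnD) simp
      finally show "norm (u x) \<le> 1 * norm x" .
    qed simp
    then have "Re (\<phi> (u o\<^sub>L T)) \<le> K"
      by (intro K uA usa)
    moreover have "u o\<^sub>L T = (B o\<^sub>L W n) o\<^sub>L B"
      unfolding u_def using WT[of n] WB[of n] B(2) by (metis comp_assoc)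
    ultimately show ?thesis
      by (simp add: BW comp.diff_left state_diff A_comp D BA)
  qed
  \<comment> \<open>the same telescoping sum, under the trace, makes the defects summable\<close>
  have "r * (\<Sum>k<n. Re (\<phi> (D k o\<^sub>L B))) \<le> 1" for n
  proof -
    have "\<phi> (B o\<^sub>L W n) = complex_of_real r * (\<Sum>k<n. \<phi> (D k o\<^sub>L B))"
      by (simp add: W_def comp.scaleR_right comp.sum_right DB state_scaleR state_sum A_sum A_comp D BA)
    then have "r * (\<Sum>k<n. Re (\<phi> (D k o\<^sub>L B))) = Re (\<phi> (id_blinfun - D n))"
      by (simp add: BW)
    also have "\<dots> \<le> 1"
      using state_nonneg[OF D(3) D(1), of n] by (simp add: state_diff A_id D state_one)
    finally show ?thesis .
  qed
  then have "summable (\<lambda>k. Re (\<phi> (D k o\<^sub>L B)))"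
    using r(1) by (intro summableI_nonneg_bounded[of _ "1 / r"] state_positive_comp D BA B)
      (simp add: field_simps)
  then have "(\<lambda>n. Re (\<phi> (D n o\<^sub>L B))) \<longlonglongrightarrow> 0"
    by (rule summable_LIMSEQ_zero)
  then have "Re (\<phi> B) - K \<le> 0"
    using defect by (intro LIMSEQ_le_const) auto
  then show ?thesis
    by (simp add: trace_norm_def B_def)
qed

end

section \<open>The estimate for the free Poisson random measure\<close>

text \<open>The only partition of a single point is the one-block partition, so the recursion for the
  cumulant has an empty correction sum.\<close>

lemma first_free_cumulant: "free_cumulant \<phi> [a] = \<phi> a"
proof -
  have zero: "{..<length [a]} = {0}"
    by auto
  have "P = {{..<length [a]}}" if "P \<in> NC (length [a])" for P
  proof -
    have P: "partition_on {..<length [a]} P"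
      using that by (simp add: NC_def)
    have union: "\<Union>P = {0}" "{} \<notin> P"
      using partition_onD1[OF P] partition_onD3[OF P] zero by metis+
    have "V = {0}" if "V \<in> P" for V
      using union that by (metis Sup_upper subset_singletonD)
    moreover have "P \<noteq> {}"
      using union(1) by force
    ultimately have "P = {{0}}"
      by blast
    then show ?thesis by (simp only: zero)
  qed
  then have "NC (length [a]) - {{{..<length [a]}}} = {}"
    by blast
  then show ?thesis
    by (simp only: free_cumulant.simps[of \<phi> "[a]"] sum.empty) (simp add: prod_op_def)
qed

lemma L1_norm_simple:
  assumes "finite I" "disjoint_family_on E I" "\<And>i. i \<in> I \<Longrightarrow> E i \<in> finite_borel_sets"
  shows "L1_norm (\<lambda>x. \<Sum>i\<in>I. c i * indicator (E i) x) = (\<Sum>i\<in>I. \<bar>c i\<bar> * measure lborel (E i))"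
proof -
  have "\<bar>\<Sum>i\<in>I. c i * indicator (E i) x\<bar> = (\<Sum>i\<in>I. \<bar>c i\<bar> * indicator (E i) x)" for x
  proof (cases "\<exists>j\<in>I. x \<in> E j")
    case True
    then obtain j where j: "j \<in> I" "x \<in> E j" by blast
    have "indicator (E i) x = (if i = j then 1 else 0 :: real)" if "i \<in> I" for i
      using assms(2) j that by (auto simp: disjoint_family_on_def indicator_def)
    then have "(\<Sum>i\<in>I. d i * indicator (E i) x) = (\<Sum>i\<in>I. if i = j then d i else 0)"
      for d :: "_ \<Rightarrow> real"
      by (intro sum.cong) auto
    then have "(\<Sum>i\<in>I. d i * indicator (E i) x) = d j" for d :: "_ \<Rightarrow> real"
      using assms(1) j(1) by (simp only: sum.delta) simp
    then show ?thesis by simp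
  next
    case False
    then show ?thesis by simp
  qed
  moreover have "integrable lborel (\<lambda>x. \<bar>c i\<bar> * indicator (E i) x)" if "i \<in> I" for i
    using assms(3)[OF that] by (auto simp: finite_borel_sets_def)
  ultimately show ?thesis
    unfolding L1_norm_def using assms(3) by (simp add: finite_borel_sets_def)
qed

theorem lemma6p4:
  fixes A :: "'h::complex_hilbert operator set"
    and \<phi> :: "'h operator \<Rightarrow> complex"
    and X :: "real set \<Rightarrow> 'h operator"
    and n :: nat and c :: "nat \<Rightarrow> real" and E :: "nat \<Rightarrow> real set"
  assumes "wstar_probability_space A \<phi>"
    and "free_poisson_random_measure A \<phi> X"
    and "\<And>F. F \<in> finite_borel_sets \<Longrightarrow> positive_op (X F)"
    and "\<And>i. i \<in> {1..n} \<Longrightarrow> E i \<in> finite_borel_sets"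
    and "disjoint_family_on E {1..n}"
  shows "trace_norm \<phi> (\<Sum>i=1..n. c i *\<^sub>R centered X (E i))
     \<le> 2 * L1_norm (\<lambda>x. \<Sum>i=1..n. c i * indicator (E i) x)"
proof -
  interpret wstar_probability_space A \<phi> by fact
  define m where "m i = measure lborel (E i)" for i
  have X: "X (E i) \<in> A" "positive_op (X (E i))" "\<phi> (X (E i)) = complex_of_real (m i)"
    if "i \<in> {1..n}" for i
  proof -
    show "X (E i) \<in> A" "positive_op (X (E i))"
      using assms(2-4) that by (auto simp: free_poisson_random_measure_def)
    have "free_cumulant \<phi> (replicate 1 (X (E i))) = complex_of_real (m i)"
      using assms(2,4) that unfolding free_poisson_random_measure_def m_def by blast
    then show "\<phi> (X (E i)) = complex_of_real (m i)"
      by (simp add: first_free_cumulant)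
  qed
  have centered: "centered X (E i) = X (E i) - m i *\<^sub>R id_blinfun" for i
    by (simp add: centered_def m_def)
  have XA: "centered X (E i) \<in> A" "selfadjoint_op (centered X (E i))" if "i \<in> {1..n}" for i
    unfolding centered using X[OF that]
    by (auto intro: A_diff A_scaleR A_id selfadjoint_diff selfadjoint_scaleR selfadjoint_id
        positive_op_selfadjoint)
  have "trace_norm \<phi> (\<Sum>i=1..n. c i *\<^sub>R centered X (E i)) \<le> (\<Sum>i=1..n. \<bar>c i\<bar> * (2 * m i))"
  proof (rule trace_norm_le)
    fix u assume u: "u \<in> A" "selfadjoint_op u" "norm u \<le> 1"
    have *: "\<bar>Re (\<phi> (u o\<^sub>L centered X (E i)))\<bar> \<le> 2 * m i" if i: "i \<in> {1..n}" for i
    proof -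
      have "Re (\<phi> (u o\<^sub>L centered X (E i))) = Re (\<phi> (u o\<^sub>L X (E i))) - m i * Re (\<phi> u)"
        using u(1) X(1)[OF i]
        by (simp add: centered comp.diff_right comp.scaleR_right state_diff state_scaleR A_comp A_scaleR)
      moreover have "\<bar>Re (\<phi> (u o\<^sub>L X (E i)))\<bar> \<le> m i"
        using state_contraction_comp_le[OF u X(1,2)[OF i]] X(3)[OF i] by simp
      moreover have "\<bar>Re (\<phi> u)\<bar> \<le> 1"
        using state_contraction_comp_le[OF u A_id positive_op_id] by (simp add: state_one)
      then have "\<bar>m i * Re (\<phi> u)\<bar> \<le> m i"
        by (simp add: abs_mult m_def mult_left_le)
      ultimately show ?thesis by linarith
    qed
    have "\<phi> (u o\<^sub>L (\<Sum>i=1..n. c i *\<^sub>R centered X (E i))) =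
        (\<Sum>i=1..n. \<phi> (c i *\<^sub>R (u o\<^sub>L centered X (E i))))"
      unfolding comp.sum_right comp.scaleR_right
      by (intro state_sum A_scaleR A_comp u(1) XA(1))
    also have "\<dots> = (\<Sum>i=1..n. complex_of_real (c i) * \<phi> (u o\<^sub>L centered X (E i)))"
      by (intro sum.cong refl state_scaleR A_comp u(1) XA(1))
    finally have "Re (\<phi> (u o\<^sub>L (\<Sum>i=1..n. c i *\<^sub>R centered X (E i)))) =
        (\<Sum>i=1..n. c i * Re (\<phi> (u o\<^sub>L centered X (E i))))"
      by simp
    also have "\<dots> \<le> (\<Sum>i=1..n. \<bar>c i\<bar> * (2 * m i))"
    proof (rule sum_mono)
      fix i assume "i \<in> {1..n}"
      from mult_left_mono[OF *[OF this], of "\<bar>c i\<bar>"]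
      show "c i * Re (\<phi> (u o\<^sub>L centered X (E i))) \<le> \<bar>c i\<bar> * (2 * m i)"
        by (simp flip: abs_mult)
    qed
    finally show "Re (\<phi> (u o\<^sub>L (\<Sum>i=1..n. c i *\<^sub>R centered X (E i))))
        \<le> (\<Sum>i=1..n. \<bar>c i\<bar> * (2 * m i))" .
  qed (use XA in \<open>auto intro!: A_sum A_scaleR selfadjoint_sum selfadjoint_scaleR\<close>)
  also have "\<dots> = 2 * L1_norm (\<lambda>x. \<Sum>i=1..n. c i * indicator (E i) x)"
    using L1_norm_simple[of "{1..n}" E c] assms(4,5) by (simp add: m_def sum_distrib_left mult_ac)
  finally show ?thesis .
qed

end
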